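(* Let $\phi$ be a continuous flow without singularities on a compact metric space $X$. Then a Borel probability measure $\mu$ of $X$ is expansive for $\phi$ if and only if there is $\alpha>0$ such that $\mu(\Gamma_\alpha(x))=0$ for $\mu$-a.e. $x\in X$.
   Context: Let $(X,d)$ be a metric space. A flow of $X$ is a map $\phi:\mathbb{R}\times X\to X$, written $\phi_t(x)=\phi(t,x)$, with $\phi_0(x)=x$ and $\phi(t,\phi(s,x))=\phi(t+s,x)$ for all $s,t\in\mathbb{R}$, $x\in X$; it is continuous if it is continuous as a map $\mathbb{R}\times X\to X$. A singularity of $\phi$ is a point $x$ with $\phi_t(x)=x$ for every $t\in\mathbb{R}$. $\mathcal{B}$ denotes the set of continuous maps $h:\mathbb{R}\to\mathbb{R}$ with $h(0)=0$. $B[x,\delta]$ is the closed ball. For $\delta>0$ and $x\in X$, $$\Gamma_\delta(x)=\bigcup_{h\in\mathcal{B}}\bigcap_{t\in\mathbb{R}}\phi_{-h(t)}(B[\phi_t(x),\delta]),$$ i.e. $y\in\Gamma_\delta(x)$ iff there is $h\in\mathcal{B}$ with $d(\phi_t(x),\phi_{h(t)}(y))\le\delta$ for all $t\in\mathbb{R}$. A Borel measure is a non-negative $\sigma$-additive map on the Borel $\sigma$-algebra of $X$. For an arbitrary subset $B\subset X$ one writes $\mu(B)=0$ if $\mu(A)=0$ for every Borel set $A\subset B$. A Borel measure $\mu$ is expansive for $\phi$ if there is $\delta>0$ (called an expansivity constant) such that $\mu(\Gamma_\delta(x))=0$ for every $x\in X$. *)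

theory Defs
  imports "HOL-Probability.Probability"
begin

definition flow :: "(real \<Rightarrow> 'a \<Rightarrow> 'a) \<Rightarrow> bool" where
  "flow \<phi> \<longleftrightarrow> (\<forall>x. \<phi> 0 x = x) \<and> (\<forall>t s x. \<phi> t (\<phi> s x) = \<phi> (t + s) x)"

definition continuous_flow :: "(real \<Rightarrow> 'a::metric_space \<Rightarrow> 'a) \<Rightarrow> bool" where
  "continuous_flow \<phi> \<longleftrightarrow> flow \<phi> \<and> continuous_on UNIV (\<lambda>(t, x). \<phi> t x)"

definition singularity :: "(real \<Rightarrow> 'a \<Rightarrow> 'a) \<Rightarrow> 'a \<Rightarrow> bool" where
  "singularity \<phi> x \<longleftrightarrow> (\<forall>t. \<phi> t x = x)"

text \<open>Reparametrizations are only required to be continuous and to fix the origin;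
  they need not be monotone or surjective.\<close>

definition reparams :: "(real \<Rightarrow> real) set" where
  "reparams = {h. continuous_on UNIV h \<and> h 0 = 0}"

definition Gamma_set :: "(real \<Rightarrow> 'a::metric_space \<Rightarrow> 'a) \<Rightarrow> real \<Rightarrow> 'a \<Rightarrow> 'a set" where
  "Gamma_set \<phi> \<delta> x = (\<Union>h\<in>reparams. \<Inter>t. \<phi> (- h t) ` cball (\<phi> t x) \<delta>)"

lemma mem_Gamma_set_iff:
  assumes "flow \<phi>"
  shows "y \<in> Gamma_set \<phi> \<delta> x \<longleftrightarrow> (\<exists>h\<in>reparams. \<forall>t. dist (\<phi> t x) (\<phi> (h t) y) \<le> \<delta>)"
proof -
  have "y \<in> \<phi> (- s) ` C \<longleftrightarrow> \<phi> s y \<in> C" for s C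
  proof
    assume "\<phi> s y \<in> C"
    moreover have "y = \<phi> (- s) (\<phi> s y)"
      using assms by (simp add: flow_def)
    ultimately show "y \<in> \<phi> (- s) ` C" by blast
  next
    assume "y \<in> \<phi> (- s) ` C"
    then show "\<phi> s y \<in> C" using assms by (auto simp: flow_def)
  qed
  then show ?thesis by (simp add: Gamma_set_def)
qed

text \<open>The sets \<^term>\<open>Gamma_set \<phi> \<delta> x\<close> need not be measurable, so nullity of an arbitrary
  set is defined through its measurable subsets. It is thus weaker than
  being contained in a null set, and differs from \<^term>\<open>emeasure M B = 0\<close>, which holds by
  convention for every non-measurable \<^term>\<open>B\<close>.\<close>

definition inner_null :: "'a measure \<Rightarrow> 'a set \<Rightarrow> bool" where
  "inner_null M B \<longleftrightarrow> (\<forall>A\<in>sets M. A \<subseteq> B \<longrightarrow> emeasure M A = 0)"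

text \<open>Used for Borel measures, i.e. for \<^term>\<open>M\<close> with \<^prop>\<open>sets M = sets borel\<close>.\<close>

definition expansive_measure :: "(real \<Rightarrow> 'a::metric_space \<Rightarrow> 'a) \<Rightarrow> 'a measure \<Rightarrow> bool" where
  "expansive_measure \<phi> M \<longleftrightarrow> (\<exists>\<delta>>0. \<forall>x. inner_null M (Gamma_set \<phi> \<delta> x))"

end

theory Submission
  imports Defs
begin

text \<open>
  Only the passage from almost every point to every point needs an argument. Suppose a Borel
  set \<open>A\<close> of positive measure lies in \<open>Gamma_set \<phi> \<delta> x\<close>. Since almost every point is good for \<open>\<alpha>\<close>,
  some \<open>y \<in> A\<close> is good. If the relation between \<open>x\<close> and \<open>y\<close> could be reversed, at the price of
  replacing \<open>\<delta>\<close> by \<open>\<alpha> / 2\<close>, then composing reparametrizations would put all of \<open>A\<close> inside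
  \<open>Gamma_set \<phi> \<alpha> y\<close>, which contains no Borel set of positive measure.

  Everything thus rests on the approximate symmetry \<open>Gamma_set_sym\<close>. It is not immediate,
  because a reparametrization \<open>h\<close> need not be invertible. On a compact space, however, a flow
  without singularities has no short periods, so for some small \<open>\<eta>\<close> every point is moved by at
  least some \<open>m > 0\<close> in time \<open>\<eta>\<close>. If the orbit of \<open>y\<close> run along \<open>h\<close> follows the orbit of \<open>x\<close> much
  more closely than \<open>m\<close>, then over short time spans \<open>h\<close> stays within \<open>\<eta>\<close> of a translation
  (\<open>shadowing_reparam_near_translation\<close>). A sliding average of such an \<open>h\<close> over a window longer
  than \<open>\<eta>\<close> is increasing and uniformly close to \<open>h\<close>, and its inverse is the reparametrization
  that exchanges the two orbits (\<open>sliding_average_inverse\<close>).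
\<close>

section \<open>Reparametrizations close to translations\<close>

text \<open>A continuous map that is nearly a translation on short time spans has a continuous
  approximate right inverse. The map itself may oscillate, but its average
  \<open>t \<mapsto> (1 / \<tau>) * (integral of h over [t, t + \<tau>])\<close> has derivative
  \<open>(h (t + \<tau>) - h t) / \<tau> \<ge> (\<tau> - \<eta>) / \<tau> > 0\<close>, hence a Lipschitz inverse, and up to an additive
  constant it differs from \<open>h\<close> only by the error of the translation estimate.\<close>

lemma sliding_average_inverse:
  fixes h :: "real \<Rightarrow> real"
  assumes h: "h \<in> reparams" and "0 < \<eta>" "\<eta> < \<tau>"
    and near: "\<And>t s. 0 \<le> s \<Longrightarrow> s \<le> \<tau> \<Longrightarrow> \<bar>h (t + s) - h t - s\<bar> \<le> \<eta>"
  obtains k where "k \<in> reparams" "\<And>t. \<bar>h (k t) - t\<bar> \<le> 2 * \<eta>"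
proof -
  have cont: "isCont h x" for x
    using h by (simp add: reparams_def continuous_on_eq_continuous_at)
  obtain H where H: "(H has_real_derivative h x) (at x)" for x
    using einterval_antiderivative[of "-\<infinity>" "\<infinity>" h] cont
    by (auto simp: has_real_derivative_iff_has_vector_derivative)
  \<comment> \<open>\<open>a\<close> is the sliding average of \<open>h\<close>; subtracting \<open>a 0\<close> makes it fix the origin.\<close>
  define a where "a t = (H (t + \<tau>) - H t) / \<tau>" for t
  define g where "g t = a t - a 0" for t
  define c where "c = (\<tau> - \<eta>) / \<tau>"
  have "\<tau> > 0" and "c > 0" using assms by (auto simp: c_def)
  have g0: "g 0 = 0" by (simp add: g_def)
  have dg: "(g has_real_derivative (h (t + \<tau>) - h t) / \<tau>) (at t)" for t
  proof -
    have "((\<lambda>t. H (t + \<tau>)) has_real_derivative h (t + \<tau>)) (at t)"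
      using DERIV_shift H by blast
    from DERIV_diff[OF DERIV_cdivide[OF DERIV_diff[OF this H]] DERIV_const, of \<tau> "a 0"]
    have "((\<lambda>t. (H (t + \<tau>) - H t) / \<tau> - a 0) has_real_derivative (h (t + \<tau>) - h t) / \<tau>) (at t)"
      by simp
    then show ?thesis unfolding g_def a_def .
  qed
  have expand: "c * (t - s) \<le> g t - g s" if "s \<le> t" for s t
  proof -
    have "g s - c * s \<le> g t - c * t"
    proof (rule DERIV_nonneg_imp_nondecreasing[OF that])
      fix x
      have "c \<le> (h (x + \<tau>) - h x) / \<tau>"
        using near[of \<tau> x] \<open>\<tau> > 0\<close> unfolding c_def
        by (intro divide_right_mono) (auto simp: abs_le_iff)
      moreover have "((\<lambda>x. g x - c * x) has_real_derivative (h (x + \<tau>) - h x) / \<tau> - c) (at x)"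
        by (rule derivative_eq_intros dg refl | simp)+
      ultimately show "\<exists>y. ((\<lambda>x. g x - c * x) has_real_derivative y) (at x) \<and> 0 \<le> y"
        by fastforce
    qed
    then show ?thesis by (simp add: algebra_simps)
  qed
  have avg: "\<bar>a t - h t - \<tau> / 2\<bar> \<le> \<eta>" for t
  proof -
    \<comment> \<open>\<open>F\<close> integrates the error \<open>h (t + s) - h t - s\<close> over \<open>s\<close>; the integral of the translation part
      produces the constant \<open>\<tau> / 2\<close>, which cancels in \<open>g\<close>.\<close>
    define F where "F s = H (t + s) - s * h t - s\<^sup>2 / 2" for s
    have dF: "(F has_real_derivative h (t + s) - h t - s) (at s)" for s
    proof -
      have "((\<lambda>s. H (t + s)) has_real_derivative h (t + s)) (at s)"
        using DERIV_shift[of H "h (t + s)" s t] H by (simp add: add.commute)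
      then show ?thesis unfolding F_def
        by (auto intro!: derivative_eq_intros)
    qed
    obtain z where z: "0 < z" "z < \<tau>" "F \<tau> - F 0 = (\<tau> - 0) * (h (t + z) - h t - z)"
      using MVT2[OF \<open>\<tau> > 0\<close>, of F "\<lambda>s. h (t + s) - h t - s"] dF by blast
    have "a t - h t - \<tau> / 2 = (F \<tau> - F 0) / \<tau>"
      using \<open>\<tau> > 0\<close> by (simp add: F_def a_def field_simps power2_eq_square)
    also have "\<dots> = h (t + z) - h t - z" using z \<open>\<tau> > 0\<close> by simp
    finally show ?thesis using near[of z t] z by simp
  qed
  have "h 0 = 0" using h by (simp add: reparams_def)
  have close: "\<bar>h t - g t\<bar> \<le> 2 * \<eta>" for t
    using avg[of t] avg[of 0] \<open>h 0 = 0\<close> unfolding g_def by linarith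
  have surj: "\<exists>x. g x = y" for y
  proof -
    define R where "R = \<bar>y\<bar> / c"
    have "R \<ge> 0" "c * R = \<bar>y\<bar>" using \<open>c > 0\<close> by (auto simp: R_def)
    then have "g (- R) \<le> y" "y \<le> g R" "- R \<le> R"
      using expand[of 0 R] expand[of "-R" 0] g0 by auto
    moreover have "continuous_on {- R..R} g"
      using dg DERIV_isCont by (auto intro!: continuous_at_imp_continuous_on)
    ultimately show ?thesis using IVT'[of g "-R" y R] by blast
  qed
  define k where "k y = (SOME x. g x = y)" for y
  have gk: "g (k y) = y" for y
    unfolding k_def using someI_ex[OF surj] .
  have lip: "c * \<bar>s - t\<bar> \<le> \<bar>g s - g t\<bar>" for s t
    using expand[of s t] expand[of t s] by (cases "s \<le> t") (auto simp: abs_if algebra_simps)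
  have "k 0 = 0"
    using lip[of "k 0" 0] \<open>c > 0\<close> by (simp add: gk g0 mult_le_0_iff)
  have "(1 / c)-lipschitz_on UNIV k"
  proof (rule lipschitz_onI)
    show "dist (k x) (k y) \<le> 1 / c * dist x y" for x y
      using lip[of "k x" "k y"] \<open>c > 0\<close> by (simp add: gk dist_real_def field_simps)
  qed (use \<open>c > 0\<close> in simp)
  then have "k \<in> reparams"
    using \<open>k 0 = 0\<close> lipschitz_on_continuous_on by (auto simp: reparams_def)
  moreover have "\<bar>h (k t) - t\<bar> \<le> 2 * \<eta>" for t
    using close[of "k t"] by (simp add: gk)
  ultimately show ?thesis using that by blast
qed

section \<open>Flows without singularities on compact spaces\<close>

lemma flow_uniformly_continuous:
  fixes \<phi> :: "real \<Rightarrow> 'a::metric_space \<Rightarrow> 'a"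
  assumes "compact (UNIV :: 'a set)" "continuous_flow \<phi>" "0 < e"
  obtains d where "0 < d"
    "\<And>s t x y. \<bar>s\<bar> \<le> T \<Longrightarrow> \<bar>t\<bar> \<le> T \<Longrightarrow> \<bar>s - t\<bar> < d \<Longrightarrow> dist x y < d \<Longrightarrow> dist (\<phi> s x) (\<phi> t y) < e"
proof -
  have "compact ({-T..T} \<times> (UNIV :: 'a set))"
    using assms(1) by (intro compact_Times) auto
  moreover have "continuous_on ({-T..T} \<times> UNIV) (\<lambda>(t, x). \<phi> t x)"
    using assms(2) continuous_on_subset unfolding continuous_flow_def by blast
  ultimately have "uniformly_continuous_on ({-T..T} \<times> UNIV) (\<lambda>(t, x). \<phi> t x)"
    by (rule compact_uniformly_continuous[rotated])
  then obtain d where d: "d > 0"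
    "\<And>p q. p \<in> {-T..T} \<times> UNIV \<Longrightarrow> q \<in> {-T..T} \<times> UNIV \<Longrightarrow> dist q p < d \<Longrightarrow>
      dist (case q of (t, x) \<Rightarrow> \<phi> t x) (case p of (t, x) \<Rightarrow> \<phi> t x) < e"
    using assms(3) unfolding uniformly_continuous_on_def by metis
  show ?thesis
  proof (rule that[of "d / 2"])
    fix s t and x y :: 'a
    assume A: "\<bar>s\<bar> \<le> T" "\<bar>t\<bar> \<le> T" "\<bar>s - t\<bar> < d / 2" "dist x y < d / 2"
    have "dist (s, x) (t, y) \<le> dist s t + dist x y"
      unfolding dist_Pair_Pair by (rule sqrt_sum_squares_le_sum) auto
    then have "dist (s, x) (t, y) < d" using A by (simp add: dist_real_def)
    then show "dist (\<phi> s x) (\<phi> t y) < e"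
      using d(2)[of "(t, y)" "(s, x)"] A by (auto simp: abs_le_iff)
  qed (use d in simp)
qed

lemma flow_periodic:
  assumes "flow \<phi>" "\<phi> p x = x"
  shows "\<phi> (of_int n * p) x = x"
proof -
  have neg: "\<phi> (- p) x = x"
    using assms by (metis add.left_inverse flow_def)
  show ?thesis
  proof (induction n rule: int_induct[where k = 0])
    case base
    show ?case using assms by (simp add: flow_def)
  next
    case (step1 i)
    have "\<phi> (of_int (i + 1) * p) x = \<phi> (of_int i * p) (\<phi> p x)"
      using assms(1) by (simp add: flow_def algebra_simps)
    then show ?case using step1 assms by simp
  next
    case (step2 i)
    have "\<phi> (of_int (i - 1) * p) x = \<phi> (of_int i * p) (\<phi> (- p) x)"
      using assms(1) by (simp add: flow_def algebra_simps)
    then show ?case using step2 neg by simp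
  qed
qed

text \<open>If points \<open>y n\<close> had periods \<open>p n\<close> tending to zero, then moving \<open>y n\<close> for any fixed time \<open>s\<close>
  would amount to moving it for the remainder of \<open>s\<close> modulo \<open>p n\<close>, which tends to zero. A limit
  point of \<open>y\<close> would therefore be a singularity.\<close>

lemma periods_bounded_below:
  fixes \<phi> :: "real \<Rightarrow> 'a::metric_space \<Rightarrow> 'a"
  assumes comp: "compact (UNIV :: 'a set)" and cf: "continuous_flow \<phi>"
    and nosing: "\<nexists>x. singularity \<phi> x"
  obtains p0 where "0 < p0" "\<And>p x. 0 < p \<Longrightarrow> p < p0 \<Longrightarrow> \<phi> p x \<noteq> x"
proof (rule ccontr)
  assume "\<not> thesis"
  then have "\<forall>n. \<exists>p x. 0 < p \<and> p < 1 / real (Suc n) \<and> \<phi> p x = x"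
    using that by (metis of_nat_0_less_iff zero_less_Suc zero_less_divide_1_iff)
  then obtain p y where py: "\<And>n. 0 < p n" "\<And>n. p n < 1 / real (Suc n)" "\<And>n. \<phi> (p n) (y n) = y n"
    by metis
  obtain x r where r: "strict_mono r" "(y \<circ> r) \<longlonglongrightarrow> x"
    using comp unfolding compact_eq_seq_compact_metric seq_compact_def by (metis UNIV_I)
  have flow: "flow \<phi>" and cont: "continuous_on UNIV (\<lambda>(t, x). \<phi> t x)"
    using cf by (auto simp: continuous_flow_def)
  have "\<phi> s x = x" for s
  proof -
    define u where "u n = s - of_int \<lfloor>s / p n\<rfloor> * p n" for n
    have u: "0 \<le> u n" "u n < p n" for n
    proof -
      have "of_int \<lfloor>s / p n\<rfloor> \<le> s / p n" "s / p n < of_int \<lfloor>s / p n\<rfloor> + 1" by linarith+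
      then have "of_int \<lfloor>s / p n\<rfloor> * p n \<le> s" "s < (of_int \<lfloor>s / p n\<rfloor> + 1) * p n"
        using py(1)[of n] by (simp_all only: pos_le_divide_eq pos_divide_less_eq)
      then show "0 \<le> u n" "u n < p n"
        by (auto simp: u_def algebra_simps)
    qed
    have eq: "\<phi> s (y n) = \<phi> (u n) (y n)" for n
    proof -
      have "\<phi> s (y n) = \<phi> (u n) (\<phi> (of_int \<lfloor>s / p n\<rfloor> * p n) (y n))"
        using flow by (simp add: flow_def u_def)
      then show ?thesis using flow_periodic[OF flow py(3)] by simp
    qed
    have "u \<longlonglongrightarrow> 0"
    proof (rule tendsto_sandwich[OF _ _ tendsto_const LIMSEQ_inverse_real_of_nat])
      show "\<forall>\<^sub>F n in sequentially. u n \<le> inverse (real (Suc n))"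
        using u(2) py(2) by (intro always_eventually allI) (metis inverse_eq_divide less_imp_le less_trans)
    qed (use u in auto)
    then have ur: "(u \<circ> r) \<longlonglongrightarrow> 0" using r(1) LIMSEQ_subseq_LIMSEQ by blast
    have lim: "(\<lambda>n. \<phi> (v n) ((y \<circ> r) n)) \<longlonglongrightarrow> \<phi> l x" if "v \<longlonglongrightarrow> l" for v l
      using continuous_on_tendsto_compose[OF cont tendsto_Pair[OF that r(2)]] by simp
    have "(\<lambda>n. \<phi> s ((y \<circ> r) n)) \<longlonglongrightarrow> \<phi> s x" by (rule lim) simp
    moreover have "(\<lambda>n. \<phi> s ((y \<circ> r) n)) \<longlonglongrightarrow> \<phi> 0 x"
      using lim[OF ur] by (simp add: eq)
    ultimately show ?thesis using LIMSEQ_unique flow by (metis flow_def)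
  qed
  then show False using nosing by (auto simp: singularity_def)
qed

text \<open>The bound for time \<open>\<eta>\<close> also serves for \<open>- \<eta>\<close>, since a pair \<open>x, \<phi> (- \<eta>) x\<close> is a pair
  \<open>\<phi> \<eta> z, z\<close>.\<close>

lemma displacement_bounded_below:
  fixes \<phi> :: "real \<Rightarrow> 'a::metric_space \<Rightarrow> 'a"
  assumes comp: "compact (UNIV :: 'a set)" and cf: "continuous_flow \<phi>"
    and nofix: "\<And>x. \<phi> \<eta> x \<noteq> x"
  obtains m where "0 < m" "\<And>x. m \<le> dist (\<phi> \<eta> x) x" "\<And>x. m \<le> dist (\<phi> (- \<eta>) x) x"
proof -
  have flow: "flow \<phi>" and cont: "continuous_on UNIV (\<lambda>(t, x). \<phi> t x)"
    using cf by (auto simp: continuous_flow_def)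
  have "continuous_on UNIV (\<lambda>x. \<phi> \<eta> x)"
    using continuous_on_compose2[OF cont, of UNIV "\<lambda>x. (\<eta>, x)"]
    by (simp add: continuous_on_Pair)
  then have "continuous_on UNIV (\<lambda>x. dist (\<phi> \<eta> x) x)" by (intro continuous_intros)
  then obtain z where z: "\<And>x. dist (\<phi> \<eta> z) z \<le> dist (\<phi> \<eta> x) x"
    using continuous_attains_inf[OF comp] by blast
  show ?thesis
  proof (rule that[of "dist (\<phi> \<eta> z) z"])
    fix x
    have "\<phi> \<eta> (\<phi> (- \<eta>) x) = x" using flow by (simp add: flow_def)
    then show "dist (\<phi> \<eta> z) z \<le> dist (\<phi> (- \<eta>) x) x"
      using z[of "\<phi> (- \<eta>) x"] by (simp add: dist_commute)
  qed (use nofix z in auto)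
qed

section \<open>Approximate symmetry and transitivity of the dynamical balls\<close>

text \<open>Put \<open>w = \<phi> (r + h t) y\<close>. Both \<open>w\<close> and \<open>\<phi> (h (t + r)) y\<close> are close to \<open>\<phi> (t + r) x\<close>: the
  second by shadowing at time \<open>t + r\<close>, the first by shadowing at time \<open>t\<close> followed by running
  both orbits for time \<open>r\<close>. They differ by the flow time \<open>u r = h (t + r) - h t - r\<close>, which
  therefore can never equal \<open>\<plusminus>\<eta>\<close>. Starting from \<open>u 0 = 0\<close>, continuity keeps it inside
  \<open>(- \<eta>, \<eta>)\<close>.\<close>

lemma shadowing_reparam_near_translation:
  fixes h :: "real \<Rightarrow> real"
  assumes flow: "flow \<phi>" and h: "continuous_on UNIV h" and "0 < \<eta>"
    and disp: "\<And>x. m \<le> dist (\<phi> \<eta> x) x" "\<And>x. m \<le> dist (\<phi> (- \<eta>) x) x"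
    and unif: "\<And>s x y. 0 \<le> s \<Longrightarrow> s \<le> \<tau> \<Longrightarrow> dist x y \<le> \<delta> \<Longrightarrow> dist (\<phi> s x) (\<phi> s y) < m / 2"
    and "\<delta> \<le> m / 2"
    and shadow: "\<And>t. dist (\<phi> t x) (\<phi> (h t) y) \<le> \<delta>"
    and s: "0 \<le> s" "s \<le> \<tau>"
  shows "\<bar>h (t + s) - h t - s\<bar> < \<eta>"
proof -
  define u where "u r = h (t + r) - h t - r" for r
  have add: "\<phi> a (\<phi> b z) = \<phi> (a + b) z" for a b z using flow by (simp add: flow_def)
  have avoid: "\<bar>u r\<bar> \<noteq> \<eta>" if "0 \<le> r" "r \<le> \<tau>" for r
  proof
    assume "\<bar>u r\<bar> = \<eta>"
    then have "u r = \<eta> \<or> u r = - \<eta>" by linarith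
    then have "m \<le> dist (\<phi> (u r) (\<phi> (r + h t) y)) (\<phi> (r + h t) y)" using disp by auto
    also have "\<phi> (u r) (\<phi> (r + h t) y) = \<phi> (h (t + r)) y" by (simp add: add u_def)
    also have "dist (\<phi> (h (t + r)) y) (\<phi> (r + h t) y) \<le>
        dist (\<phi> (t + r) x) (\<phi> (h (t + r)) y) + dist (\<phi> (t + r) x) (\<phi> (r + h t) y)"
      by (rule dist_triangle3)
    also have "dist (\<phi> (t + r) x) (\<phi> (r + h t) y) < m / 2"
      using unif[OF that shadow[of t]] by (simp add: add add.commute)
    finally show False using shadow[of "t + r"] \<open>\<delta> \<le> m / 2\<close> by linarith
  qed
  have "continuous_on {0..s} (\<lambda>r. \<bar>u r\<bar>)"
    unfolding u_def using h
    by (intro continuous_intros continuous_on_compose2[OF h]) auto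
  then have "\<bar>u s\<bar> < \<eta>"
    using IVT'[of "\<lambda>r. \<bar>u r\<bar>" 0 \<eta> s] avoid s \<open>0 < \<eta>\<close>
    by (force simp: u_def not_less)
  then show ?thesis by (simp add: u_def)
qed

text \<open>With \<open>k\<close> an approximate right inverse of \<open>h\<close>, the point \<open>\<phi> (k t) x\<close> is within \<open>\<delta>\<close> of
  \<open>\<phi> (h (k t)) y\<close>, which lies on the orbit of \<open>y\<close> at a time within \<open>2 * \<eta>\<close> of \<open>t\<close>, hence is near
  \<open>\<phi> t y\<close>.\<close>

lemma Gamma_set_sym:
  fixes \<phi> :: "real \<Rightarrow> 'a::metric_space \<Rightarrow> 'a"
  assumes comp: "compact (UNIV :: 'a set)" and cf: "continuous_flow \<phi>"
    and nosing: "\<nexists>x. singularity \<phi> x" and "0 < \<beta>"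
  obtains \<delta> where "0 < \<delta>" "\<And>x y. y \<in> Gamma_set \<phi> \<delta> x \<Longrightarrow> x \<in> Gamma_set \<phi> \<beta> y"
proof -
  have flow: "flow \<phi>" using cf by (simp add: continuous_flow_def)
  have add: "\<phi> a (\<phi> b z) = \<phi> (a + b) z" and zero: "\<phi> 0 z = z" for a b z
    using flow by (auto simp: flow_def)
  obtain p0 where p0: "0 < p0" "\<And>p x. 0 < p \<Longrightarrow> p < p0 \<Longrightarrow> \<phi> p x \<noteq> x"
    using periods_bounded_below[OF comp cf nosing] by blast
  obtain \<kappa> where \<kappa>: "0 < \<kappa>"
    "\<And>s t x y. \<bar>s\<bar> \<le> 1 \<Longrightarrow> \<bar>t\<bar> \<le> 1 \<Longrightarrow> \<bar>s - t\<bar> < \<kappa> \<Longrightarrow> dist x y < \<kappa> \<Longrightarrow>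
      dist (\<phi> s x) (\<phi> t y) < \<beta> / 2"
    using flow_uniformly_continuous[OF comp cf, of "\<beta> / 2" 1] \<open>0 < \<beta>\<close> by auto
  \<comment> \<open>\<open>\<eta>\<close> is below every period, and flowing for time \<open>2 * \<eta>\<close> moves points by less than \<open>\<beta> / 2\<close>;
    the averaging window is then taken to be \<open>2 * \<eta>\<close>.\<close>
  define \<eta> where "\<eta> = min (p0 / 2) (min (\<kappa> / 3) (1 / 2))"
  have \<eta>: "0 < \<eta>" "\<eta> < p0" "2 * \<eta> < \<kappa>" "2 * \<eta> \<le> 1"
    using p0 \<kappa> by (auto simp: \<eta>_def min_def)
  have move: "dist (\<phi> s z) z < \<beta> / 2" if "\<bar>s\<bar> \<le> 2 * \<eta>" for s z
    using \<kappa>(2)[of s 0 z z] that \<eta> \<kappa>(1) by (simp add: zero)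
  obtain m where m: "0 < m" "\<And>x. m \<le> dist (\<phi> \<eta> x) x" "\<And>x. m \<le> dist (\<phi> (- \<eta>) x) x"
    using displacement_bounded_below[OF comp cf p0(2)[OF \<eta>(1,2)]] by blast
  obtain d where d: "0 < d"
    "\<And>s t x y. \<bar>s\<bar> \<le> 2 * \<eta> \<Longrightarrow> \<bar>t\<bar> \<le> 2 * \<eta> \<Longrightarrow> \<bar>s - t\<bar> < d \<Longrightarrow> dist x y < d \<Longrightarrow>
      dist (\<phi> s x) (\<phi> t y) < m / 2"
    using flow_uniformly_continuous[OF comp cf, of "m / 2" "2 * \<eta>"] m by auto
  define \<delta> where "\<delta> = min (d / 2) (min (m / 2) (\<beta> / 2))"
  have \<delta>: "0 < \<delta>" "\<delta> < d" "\<delta> \<le> m / 2" "\<delta> \<le> \<beta> / 2"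
    using d(1) m(1) \<open>0 < \<beta>\<close> by (auto simp: \<delta>_def min_def)
  show ?thesis
  proof (rule that[OF \<delta>(1)])
    fix x y assume "y \<in> Gamma_set \<phi> \<delta> x"
    then obtain h where h: "h \<in> reparams" "\<And>t. dist (\<phi> t x) (\<phi> (h t) y) \<le> \<delta>"
      by (auto simp: mem_Gamma_set_iff[OF flow])
    have near: "\<bar>h (t + s) - h t - s\<bar> \<le> \<eta>" if "0 \<le> s" "s \<le> 2 * \<eta>" for t s
    proof (rule less_imp_le, rule shadowing_reparam_near_translation[OF flow _ \<eta>(1) m(2,3) _ \<delta>(3) h(2) that])
      show "continuous_on UNIV h" using h(1) by (simp add: reparams_def)
      show "dist (\<phi> s v) (\<phi> s w) < m / 2" if "0 \<le> s" "s \<le> 2 * \<eta>" "dist v w \<le> \<delta>" for s v w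
        using d(2)[of s s v w] d(1) \<delta>(2) that by simp
    qed
    obtain k where k: "k \<in> reparams" "\<And>t. \<bar>h (k t) - t\<bar> \<le> 2 * \<eta>"
      using sliding_average_inverse[OF h(1) \<eta>(1), of "2 * \<eta>"] near \<eta>(1) by auto
    have "dist (\<phi> t y) (\<phi> (k t) x) \<le> \<beta>" for t
    proof -
      have "dist (\<phi> (h (k t)) y) (\<phi> t y) < \<beta> / 2"
        using move[OF k(2)[of t], of "\<phi> t y"] by (simp add: add)
      then show ?thesis
        using dist_triangle3[of "\<phi> t y" "\<phi> (k t) x" "\<phi> (h (k t)) y"] h(2)[of "k t"] \<delta>(4)
        by (simp add: dist_commute)
    qed
    then show "x \<in> Gamma_set \<phi> \<beta> y" using k(1) by (auto simp: mem_Gamma_set_iff[OF flow])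
  qed
qed

lemma Gamma_set_trans:
  assumes flow: "flow \<phi>" and "y \<in> Gamma_set \<phi> \<beta> x" "z \<in> Gamma_set \<phi> \<delta> y"
  shows "z \<in> Gamma_set \<phi> (\<beta> + \<delta>) x"
proof -
  obtain k h where k: "k \<in> reparams" "\<And>t. dist (\<phi> t x) (\<phi> (k t) y) \<le> \<beta>"
    and h: "h \<in> reparams" "\<And>t. dist (\<phi> t y) (\<phi> (h t) z) \<le> \<delta>"
    using assms by (auto simp: mem_Gamma_set_iff[OF flow])
  have "(\<lambda>t. h (k t)) \<in> reparams"
    using h(1) k(1) by (auto simp: reparams_def intro: continuous_on_compose2)
  moreover have "dist (\<phi> t x) (\<phi> (h (k t)) z) \<le> \<beta> + \<delta>" for t
    using dist_triangle[of "\<phi> t x" "\<phi> (h (k t)) z" "\<phi> (k t) y"] k(2)[of t] h(2)[of "k t"] by linarith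
  ultimately show ?thesis
    unfolding mem_Gamma_set_iff[OF flow] by (intro bexI[of _ "\<lambda>t. h (k t)"]) auto
qed

lemma Gamma_set_mono: "\<delta> \<le> \<epsilon> \<Longrightarrow> Gamma_set \<phi> \<delta> x \<subseteq> Gamma_set \<phi> \<epsilon> x"
  unfolding Gamma_set_def by (intro UN_mono INT_greatest subset_refl)
    (meson INT_lower UNIV_I image_mono order_trans subset_cball)

theorem theorem2p1:
  fixes \<phi> :: "real \<Rightarrow> 'a::metric_space \<Rightarrow> 'a"
    and \<mu> :: "'a measure"
  assumes "compact (UNIV :: 'a set)"
    and "continuous_flow \<phi>"
    and "\<nexists>x. singularity \<phi> x"
    and "sets \<mu> = sets borel"
    and "prob_space \<mu>"
  shows "expansive_measure \<phi> \<mu> \<longleftrightarrow>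
    (\<exists>\<alpha>>0. AE x in \<mu>. inner_null \<mu> (Gamma_set \<phi> \<alpha> x))"
proof
  assume "expansive_measure \<phi> \<mu>"
  then show "\<exists>\<alpha>>0. AE x in \<mu>. inner_null \<mu> (Gamma_set \<phi> \<alpha> x)"
    by (auto simp: expansive_measure_def)
next
  assume "\<exists>\<alpha>>0. AE x in \<mu>. inner_null \<mu> (Gamma_set \<phi> \<alpha> x)"
  then obtain \<alpha> where \<alpha>: "\<alpha> > 0" and good: "AE x in \<mu>. inner_null \<mu> (Gamma_set \<phi> \<alpha> x)"
    by blast
  have flow: "flow \<phi>" using assms(2) by (simp add: continuous_flow_def)
  obtain \<delta>' where \<delta>': "0 < \<delta>'" "\<And>x y. y \<in> Gamma_set \<phi> \<delta>' x \<Longrightarrow> x \<in> Gamma_set \<phi> (\<alpha> / 2) y"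
    using Gamma_set_sym[OF assms(1-3), of "\<alpha> / 2"] \<alpha> by auto
  define \<delta> where "\<delta> = min \<delta>' (\<alpha> / 2)"
  have "emeasure \<mu> A = 0" if A: "A \<in> sets \<mu>" "A \<subseteq> Gamma_set \<phi> \<delta> x" for A x
  proof (rule ccontr)
    assume pos: "emeasure \<mu> A \<noteq> 0"
    obtain y where y: "y \<in> A" "inner_null \<mu> (Gamma_set \<phi> \<alpha> y)"
    proof (rule ccontr)
      assume "\<not> thesis"
      then have "AE y in \<mu>. y \<notin> A"
        using good that by (auto elim!: AE_mp)
      then show False using AE_iff_measurable[OF A(1), of "\<lambda>y. y \<notin> A"] A(1) pos
        sets.sets_into_space[OF A(1)] by auto
    qed
    have "x \<in> Gamma_set \<phi> (\<alpha> / 2) y"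
    proof (rule \<delta>'(2))
      have "Gamma_set \<phi> \<delta> x \<subseteq> Gamma_set \<phi> \<delta>' x"
        by (rule Gamma_set_mono) (simp add: \<delta>_def)
      then show "y \<in> Gamma_set \<phi> \<delta>' x" using y(1) A(2) by blast
    qed
    then have "Gamma_set \<phi> \<delta> x \<subseteq> Gamma_set \<phi> (\<alpha> / 2 + \<delta>) y"
      using Gamma_set_trans[OF flow] by blast
    also have "\<dots> \<subseteq> Gamma_set \<phi> \<alpha> y"
      by (rule Gamma_set_mono) (simp add: \<delta>_def)
    finally have "A \<subseteq> Gamma_set \<phi> \<alpha> y" using A(2) by blast
    then show False using y(2) A(1) pos by (auto simp: inner_null_def)
  qed
  moreover have "\<delta> > 0" using \<delta>'(1) \<alpha> by (simp add: \<delta>_def)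
  ultimately show "expansive_measure \<phi> \<mu>"
    by (auto simp: expansive_measure_def inner_null_def)
qed

end
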